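(* Let $d\ge2$ be an integer. A linear $(d-1)$-thrackle with $m$ facets and $n$ ridges satisfies $dm\le 2n$.
   Context: A simplicial complex of dimension $e$ is pure if every face is contained in an $e$-dimensional face (facet). For $e\ge1$, a pure $e$-dimensional simplicial complex $K$ is an $e$-thrackle if there is a continuous map $f\colon K\to\mathbb{R}^{e+1}$ such that (i) the restriction of $f$ to any facet is an embedding; (ii) for any two facets $\sigma\ne\tau$, $f(\sigma)\cap f(\tau)$ is an $(e-1)$-ball; (iii) intersections between faces are stable, i.e. there is $\varepsilon>0$ such that no homotopy moving points by at most $\varepsilon$ can remove the intersection. If $f$ can be chosen linear (affine) on each facet, $K$ is a linear $e$-thrackle. The $(e-1)$-dimensional faces of an $e$-thrackle are called ridges; here $e=d-1$, so ridges are the $(d-2)$-faces and the map goes to $\mathbb{R}^d$. *)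

theory Defs
  imports "HOL-Analysis.Analysis"
begin

text \<open>
  A finite simplicial complex is a geometric one (\<^const>\<open>simplicial_complex\<close>) in an arbitrary
  Euclidean space; every finite abstract complex has such a realization. Its polyhedron is the
  union of its simplices. The empty simplex, of dimension -1, is allowed as a face.
\<close>

definition dim_faces :: "int \<Rightarrow> 'a::euclidean_space set set \<Rightarrow> 'a set set" where
  "dim_faces k K = {S \<in> K. k simplex S}"

definition facets :: "nat \<Rightarrow> 'a::euclidean_space set set \<Rightarrow> 'a set set" where
  "facets e K = dim_faces (int e) K"

definition ridges :: "nat \<Rightarrow> 'a::euclidean_space set set \<Rightarrow> 'a set set" where
  "ridges e K = dim_faces (int e - 1) K"

definition pure_complex :: "nat \<Rightarrow> 'a::euclidean_space set set \<Rightarrow> bool" where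
  "pure_complex e K \<longleftrightarrow>
     simplicial_complex K \<and> facets e K \<noteq> {} \<and> (\<forall>S\<in>K. aff_dim S \<le> int e) \<and>
     (\<forall>S\<in>K. \<exists>\<sigma>\<in>facets e K. S face_of \<sigma>)"

text \<open>
  The model of a \<open>k\<close>-ball is the closed unit ball of a \<open>k\<close>-dimensional linear subspace of the
  ambient space (all such subspaces are isometric to \<open>k\<close>-dimensional Euclidean space).
  A 0-ball is a point. If \<open>k\<close> exceeds the dimension of the ambient space, no set is a \<open>k\<close>-ball,
  in accordance with invariance of dimension.
\<close>

definition is_top_ball :: "nat \<Rightarrow> 'b::euclidean_space set \<Rightarrow> bool" where
  "is_top_ball k S \<longleftrightarrow>
     (\<exists>V::'b set. subspace V \<and> dim V = k \<and> S homeomorphic (cball 0 1 \<inter> V))"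

text \<open>
  Stability: the homotopy is one of the map \<open>f\<close> on the whole polyhedron, and at every time each
  point is within \<open>\<epsilon>\<close> of its original position. Removing an intersection means making the
  images of the two faces disjoint; so two faces with a common vertex always meet stably.
\<close>

definition stable_intersections ::
    "'a::euclidean_space set set \<Rightarrow> ('a \<Rightarrow> 'b::euclidean_space) \<Rightarrow> bool" where
  "stable_intersections K f \<longleftrightarrow>
     (\<exists>\<epsilon>>0. \<forall>\<sigma>\<in>K. \<forall>\<tau>\<in>K. f ` \<sigma> \<inter> f ` \<tau> \<noteq> {} \<longrightarrow>
        \<not> (\<exists>g. homotopic_with_canon (\<lambda>h. \<forall>x\<in>\<Union>K. dist (f x) (h x) \<le> \<epsilon>) (\<Union>K) UNIV f g \<and>
               g ` \<sigma> \<inter> g ` \<tau> = {}))"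

definition thrackle_map ::
    "nat \<Rightarrow> 'a::euclidean_space set set \<Rightarrow> ('a \<Rightarrow> real ^ 'd) \<Rightarrow> bool" where
  "thrackle_map e K f \<longleftrightarrow>
     1 \<le> e \<and> CARD('d) = e + 1 \<and> pure_complex e K \<and> continuous_on (\<Union>K) f \<and>
     (\<forall>\<sigma>\<in>facets e K. embedding_map (top_of_set \<sigma>) euclidean f) \<and>
     (\<forall>\<sigma>\<in>facets e K. \<forall>\<tau>\<in>facets e K. \<sigma> \<noteq> \<tau> \<longrightarrow> is_top_ball (e - 1) (f ` \<sigma> \<inter> f ` \<tau>)) \<and>
     stable_intersections K f"

definition affine_map_on :: "'a::real_vector set \<Rightarrow> ('a \<Rightarrow> 'b::real_vector) \<Rightarrow> bool" where
  "affine_map_on S f \<longleftrightarrow> (\<exists>A b. linear A \<and> (\<forall>x\<in>S. f x = A x + b))"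

definition linear_thrackle_map ::
    "nat \<Rightarrow> 'a::euclidean_space set set \<Rightarrow> ('a \<Rightarrow> real ^ 'd) \<Rightarrow> bool" where
  "linear_thrackle_map e K f \<longleftrightarrow>
     thrackle_map e K f \<and> (\<forall>\<sigma>\<in>facets e K. affine_map_on \<sigma> f)"

end

theory Submission imports Defs begin

text \<open>
  The argument generalizes Perles' proof for linear thrackles in the plane. Consider triples of a
  facet \<open>\<sigma>\<close>, a ridge \<open>R\<close> of \<open>\<sigma>\<close> and a side of the hyperplane \<open>H\<close> spanned by the image of \<open>\<sigma>\<close>, and
  call the triple blocked if another facet at \<open>R\<close> lies on that side (facets inside \<open>H\<close> are assigned
  to the closed upper side). If the upper side is blocked at \<open>R\<close> by \<open>\<tau>\<close> and the lower side at
  \<open>R' \<noteq> R\<close> by \<open>\<tau>'\<close>, then the images of \<open>\<tau>\<close> and \<open>\<tau>'\<close> meet only in the image of \<open>R \<inter> R'\<close>, which is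
  too small to be a ball of dimension \<open>d - 2\<close>. Hence every facet has at least \<open>d\<close> unblocked triples.
  Conversely a ridge has at most two, because among three facets at \<open>R\<close> some hyperplane has the
  other two on different sides.
\<close>

section \<open>Cones over a convex base\<close>

lemma mem_convex_hull_insert_cases:
  assumes "convex P" "P \<noteq> {}" "x \<in> convex hull (insert w P)"
  obtains u p where "0 \<le> u" "u \<le> 1" "p \<in> P" "x = (1 - u) *\<^sub>R w + u *\<^sub>R p"
  using assms by (auto simp: convex_hull_insert_alt hull_same)

text \<open>Solving for \<open>w\<close> writes it as an affine combination of the other two points,
  with weights \<open>1 / (1 - u)\<close> and \<open>1 - 1 / (1 - u)\<close>.\<close>

lemma affine_extrapolate:
  assumes "affine A" "p \<in> A" "(1 - u) *\<^sub>R w + u *\<^sub>R p \<in> A" "u \<noteq> 1"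
  shows "w \<in> A"
proof -
  have "(1 / (1 - u)) *\<^sub>R ((1 - u) *\<^sub>R w + u *\<^sub>R p) + (1 - 1 / (1 - u)) *\<^sub>R p \<in> A"
    by (rule mem_affine) (use assms in auto)
  moreover have "(1 / (1 - u)) *\<^sub>R ((1 - u) *\<^sub>R w + u *\<^sub>R p) + (1 - 1 / (1 - u)) *\<^sub>R p
      = w + (u / (1 - u) + (1 - 1 / (1 - u))) *\<^sub>R p"
    using assms(4) by (simp add: scaleR_add_right scaleR_add_left)
  moreover have "u / (1 - u) + (1 - 1 / (1 - u)) = 0"
    using assms(4) by (simp add: field_simps)
  ultimately show ?thesis by simp
qed

text \<open>By extrapolation, a point of the cone in \<open>A\<close> with weight
  \<open>u \<noteq> 1\<close> on the base would drag the apex into \<open>A\<close>.\<close>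

lemma convex_hull_insert_Int_affine:
  assumes "convex P" "P \<noteq> {}" "affine A" "w \<notin> A" "P \<subseteq> A"
  shows "convex hull (insert w P) \<inter> A = P"
proof
  show "P \<subseteq> convex hull (insert w P) \<inter> A"
    using assms(5) hull_subset[of "insert w P" convex] by auto
  show "convex hull (insert w P) \<inter> A \<subseteq> P"
  proof
    fix x assume x: "x \<in> convex hull (insert w P) \<inter> A"
    then obtain u p where u: "0 \<le> u" "u \<le> 1" "p \<in> P" "x = (1 - u) *\<^sub>R w + u *\<^sub>R p"
      using mem_convex_hull_insert_cases[OF assms(1,2), of x w] by blast
    then have "u = 1" using affine_extrapolate[OF assms(3), of p u w] x assms by auto
    then show "x \<in> P" using u by simp
  qed
qed

text \<open>Modulo the directions of \<open>P\<close> the apices lie on the same ray from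
  \<open>p\<close>. A short step from \<open>p\<close> towards \<open>w2\<close> also lies on a
  segment from a base point \<open>q\<close> to \<open>w1\<close>: since \<open>p\<close> is
  relatively interior, the base absorbs the shift along \<open>t\<close>.\<close>

lemma simplices_on_same_side_overlap:
  fixes P :: "'b::euclidean_space set"
  assumes "convex P" "p \<in> rel_interior P" "w2 - p = l *\<^sub>R (w1 - p) + t" "l > 0"
    and t: "p + t \<in> affine hull P" and w2: "w2 \<notin> affine hull P"
  shows "\<not> convex hull (insert w1 P) \<inter> convex hull (insert w2 P) \<subseteq> affine hull P"
proof -
  obtain e where e: "e > 0" "cball p e \<inter> affine hull P \<subseteq> P" and p: "p \<in> P"
    using assms(2) by (auto simp: mem_rel_interior_cball)
  \<comment> \<open>Length of the step towards \<open>w2\<close>. The bounds keep it on the segment,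
    give \<open>r * l \<le> 1/2\<close>, and keep \<open>q\<close> within \<open>e\<close> of
    \<open>p\<close>; the \<open>+ 1\<close> covers \<open>t = 0\<close>.\<close>
  define r where "r = min (1/2) (min (1 / (2 * l)) (e / (2 * (norm t + 1))))"
  have "r > 0"
    using e assms(4) by (auto simp: r_def add_nonneg_pos)
  have r: "r > 0" "r \<le> 1/2" and "r \<le> 1 / (2 * l)" and "r \<le> e / (2 * (norm t + 1))"
    using \<open>r > 0\<close> unfolding r_def by linarith+
  have rl: "r * l \<le> 1/2"
    using \<open>r \<le> 1 / (2 * l)\<close> assms(4) by (simp add: field_simps)
  have "r * (2 * (norm t + 1)) \<le> e"
    using \<open>r \<le> e / (2 * (norm t + 1))\<close>
    by (subst (asm) pos_le_divide_eq) (auto intro: add_nonneg_pos)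
  then have rt: "2 * r * norm t \<le> e" using r by (simp add: algebra_simps)
  \<comment> \<open>Chosen so that \<open>(1 - r * l) * c = r\<close>; then \<open>x\<close> below
    is a convex combination of \<open>q\<close> and \<open>w1\<close>.\<close>
  define c where "c = r / (1 - r * l)"
  have c: "0 < c" "c \<le> 2 * r"
    using r rl assms(4) by (auto simp: c_def field_simps)
  define q where "q = p + c *\<^sub>R t"
  have "q = (1 - c) *\<^sub>R p + c *\<^sub>R (p + t)" by (simp add: q_def algebra_simps)
  then have "q \<in> affine hull P"
    using t p by (metis affine_affine_hull diff_add_cancel hull_inc mem_affine)
  moreover have "dist p q \<le> e"
  proof -
    have "c * norm t \<le> 2 * r * norm t" using c by (intro mult_right_mono) auto
    then show ?thesis using rt c by (simp add: q_def dist_norm)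
  qed
  ultimately have q: "q \<in> P" using e by auto
  define x where "x = (1 - r) *\<^sub>R p + r *\<^sub>R w2"
  have w2eq: "w2 = p + l *\<^sub>R (w1 - p) + t" using assms(3) by (simp add: algebra_simps)
  have "(1 - r * l) *\<^sub>R q = (1 - r * l) *\<^sub>R p + r *\<^sub>R t"
    using rl by (simp add: q_def c_def scaleR_add_right)
  then have x': "x = (1 - r * l) *\<^sub>R q + (r * l) *\<^sub>R w1"
    unfolding x_def w2eq by (simp add: algebra_simps)
  have "x \<in> convex hull (insert w1 P)"
    unfolding x' by (rule convexD[OF convex_convex_hull]) (use q rl r assms(4) in \<open>auto intro: hull_inc\<close>)
  moreover have "x \<in> convex hull (insert w2 P)"
    unfolding x_def by (rule convexD[OF convex_convex_hull]) (use p r in \<open>auto intro: hull_inc\<close>)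
  moreover have "x \<notin> affine hull P"
    using affine_extrapolate[OF affine_affine_hull, of p P "1 - r" w2] w2 p r
    by (auto simp: x_def add.commute hull_inc)
  ultimately show ?thesis by auto
qed

section \<open>Three facets around a common ridge\<close>

text \<open>The orthogonal complement of \<open>D\<close> is a plane, so the two independent normals
  in it span it, and the third normal lies there too.\<close>

lemma three_orthogonal_functionals:
  fixes a :: "'i \<Rightarrow> 'b::euclidean_space"
  assumes D: "subspace D" "int (dim D) = int DIM('b) - 2"
    and orth: "\<And>x v. x \<in> {i,j,k} \<Longrightarrow> v \<in> D \<Longrightarrow> a x \<bullet> v = 0"
    and ind: "a i \<noteq> 0" "a j \<noteq> 0" "\<And>c. a i \<noteq> c *\<^sub>R a j"
  obtains \<alpha> \<beta> where "a k = \<alpha> *\<^sub>R a i + \<beta> *\<^sub>R a j"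
proof -
  define C where "C = {y \<in> UNIV. \<forall>x \<in> D. orthogonal x y}"
  have "dim C + dim D = dim (UNIV :: 'b set)"
    unfolding C_def using D by (intro dim_subspace_orthogonal_to_vectors) auto
  then have C: "dim C = 2" using D(2) by simp
  have aC: "a i \<in> C" "a j \<in> C" "a k \<in> C"
    using orth by (auto simp: C_def orthogonal_def inner_commute)
  have "a i \<notin> span {a j}" using ind(3) by (auto simp: span_singleton)
  then have "independent {a i, a j}"
    using ind(2) by (auto simp: independent_insert)
  moreover have "card {a i, a j} = 2" using ind(3)[of 1] by auto
  ultimately have "C \<subseteq> span {a i, a j}"
    using C aC by (intro card_ge_dim_independent) auto
  then have "a k \<in> span {a i, a j}" using aC by auto
  then obtain x where "a k - x *\<^sub>R a i \<in> span {a j}" by (auto simp: span_insert)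
  then obtain y where "a k - x *\<^sub>R a i = y *\<^sub>R a j" by (auto simp: span_singleton)
  then show thesis by (intro that[of x y]) (simp add: algebra_simps)
qed

text \<open>
  Modulo the directions of \<open>P\<close> this is a statement about three rays in a plane. The normals
  satisfy \<open>a k = \<alpha> a i + \<beta> a j\<close>; evaluating on the three apices forces three signs to be
  pairwise opposite. Two coplanar simplices have to be treated separately, since then the
  relation degenerates.
\<close>
lemma three_simplices_around_ridge:
  fixes P :: "'b::euclidean_space set" and w a :: "'i \<Rightarrow> 'b"
  assumes P: "convex P" "P \<noteq> {}" "aff_dim P = int DIM('b) - 2"
    and w: "\<And>i. i \<in> I \<Longrightarrow> w i \<notin> affine hull P"
    and hyp: "\<And>i. i \<in> I \<Longrightarrow> affine hull (insert (w i) P) = {x. a i \<bullet> x = b i}"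
    and meet: "\<And>i j. i \<in> I \<Longrightarrow> j \<in> I \<Longrightarrow> i \<noteq> j \<Longrightarrow>
      convex hull (insert (w i) P) \<inter> convex hull (insert (w j) P) \<subseteq> affine hull P"
    and I: "card I = 3"
    and side: "\<And>i j k. i \<in> I \<Longrightarrow> j \<in> I \<Longrightarrow> k \<in> I \<Longrightarrow> distinct [i, j, k] \<Longrightarrow>
      b i \<le> a i \<bullet> w j \<longleftrightarrow> b i \<le> a i \<bullet> w k"
  shows False
proof -
  obtain p where p: "p \<in> rel_interior P"
    using P rel_interior_eq_empty by blast
  then have pP: "p \<in> P" using rel_interior_subset by blast
  define u where "u i = w i - p" for i
  define D where "D = span ((\<lambda>x. -p + x) ` P)"
  have aff: "affine hull P = (\<lambda>x. p + x) ` D"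
    unfolding D_def by (rule affine_hull_span_gen) (use pP in \<open>auto intro: hull_inc\<close>)
  have D: "subspace D" "int (dim D) = int DIM('b) - 2"
    using P(3) aff_dim_eq_dim[of p P] pP by (auto simp: D_def hull_inc)
  have sub: "affine hull P \<subseteq> {x. a i \<bullet> x = b i}" if "i \<in> I" for i
    using hyp[OF that] hull_mono[of P "insert (w i) P" affine] by auto
  have b: "b i = a i \<bullet> p" if "i \<in> I" for i
    using sub[OF that] hull_inc[OF pP, of affine] by auto
  have aD: "a i \<bullet> v = 0" if "i \<in> I" "v \<in> D" for i v
  proof -
    have "p + v \<in> affine hull P" using that aff by auto
    then show ?thesis using sub[OF that(1)] b[OF that(1)] by (auto simp: inner_add_right)
  qed
  have aw: "a i \<bullet> w j = b i + a i \<bullet> u j" if "i \<in> I" for i j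
    using b[OF that] by (simp add: u_def inner_diff_right)
  have self: "a i \<bullet> u i = 0" if "i \<in> I" for i
  proof -
    have "w i \<in> {x. a i \<bullet> x = b i}"
      unfolding hyp[OF that, symmetric] by (simp add: hull_inc)
    then show ?thesis using aw[OF that, of i] by simp
  qed
  have uD: "u i \<notin> D" if "i \<in> I" for i
  proof
    assume "u i \<in> D"
    then have "p + u i \<in> affine hull P" unfolding aff by blast
    then show False using w[OF that] by (simp add: u_def)
  qed
  \<comment> \<open>A positive factor would make the two simplices overlap off the ridge, contrary
    to \<open>meet\<close>.\<close>
  have uneg: "l < 0" if ij: "i \<in> I" "j \<in> I" "i \<noteq> j" and eq: "u j = l *\<^sub>R u i + t" "t \<in> D" for i j l t
  proof -
    have "l \<noteq> 0" using uD[OF ij(2)] eq by auto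
    moreover have "\<not> l > 0"
    proof
      assume "l > 0"
      have "p + t \<in> affine hull P" using aff eq by auto
      then show False
        using simplices_on_same_side_overlap[OF P(1) p _ \<open>l > 0\<close> _ w[OF ij(2)], of "w i" t]
          meet[OF ij] eq(1) by (auto simp: u_def)
    qed
    ultimately show ?thesis by simp
  qed
  \<comment> \<open>Here \<open>w j\<close> lies in the hyperplane of \<open>i\<close>, whose
    directions are spanned by \<open>D\<close> and \<open>u i\<close>.\<close>
  have cop: "\<exists>l t. u j = l *\<^sub>R u i + t \<and> t \<in> D \<and> l < 0"
    if ij: "i \<in> I" "j \<in> I" "i \<noteq> j" and z: "a i \<bullet> u j = 0" for i j
  proof -
    have "w j \<in> affine hull (insert (w i) P)"
      unfolding hyp[OF ij(1)] using aw[OF ij(1), of j] z by simp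
    moreover have "affine hull (insert (w i) P) = (\<lambda>x. p + x) ` span ((\<lambda>x. -p + x) ` insert (w i) P)"
      by (rule affine_hull_span_gen) (use pP in \<open>auto intro: hull_inc\<close>)
    ultimately have "u j \<in> span ((\<lambda>x. -p + x) ` insert (w i) P)"
      by (auto simp: u_def)
    then obtain l where "u j - l *\<^sub>R u i \<in> D"
      by (auto simp: span_insert D_def u_def)
    moreover have "u j = l *\<^sub>R u i + (u j - l *\<^sub>R u i)" by simp
    ultimately show ?thesis using uneg[OF ij] by blast
  qed
  show False
  proof (cases "\<exists>i\<in>I. \<exists>j\<in>I. i \<noteq> j \<and> a i \<bullet> u j = 0")
    case True
    then obtain i j where ij: "i \<in> I" "j \<in> I" "i \<noteq> j" "a i \<bullet> u j = 0" by blast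
    obtain l t where l: "u j = l *\<^sub>R u i + t" "t \<in> D" "l < 0" using cop[OF ij] by blast
    have "\<not> I \<subseteq> {i, j}"
      using I card_mono[of "{i,j}" I] ij(3) by auto
    then obtain k where k: "k \<in> I" "k \<noteq> i" "k \<noteq> j" by auto
    have eq: "a k \<bullet> u j = l * (a k \<bullet> u i)"
      using l aD[OF k(1) l(2)] by (simp add: inner_add_right)
    show False
    proof (cases "a k \<bullet> u i = 0")
      case True
      \<comment> \<open>All three simplices are coplanar. Two opposite pairs of apices leave the
        third pair on the same side, since \<open>l * m\<close> is positive.\<close>
      obtain m s where m: "u i = m *\<^sub>R u k + s" "s \<in> D" "m < 0"
        using cop[OF k(1) ij(1) k(2) True] by blast
      have "u j = (l * m) *\<^sub>R u k + (l *\<^sub>R s + t)" using l m by (simp add: algebra_simps)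
      moreover have "l *\<^sub>R s + t \<in> D" using D l m by (intro subspace_add subspace_scale) auto
      ultimately have "l * m < 0" using uneg[OF k(1) ij(2) k(3)] by blast
      then show False using l m by (simp add: mult_less_0_iff)
    next
      case False
      \<comment> \<open>Modulo \<open>D\<close>, \<open>u j\<close> is a negative multiple of
        \<open>u i\<close>, so \<open>a k\<close> gives them opposite signs, whereas
        \<open>side\<close> makes the signs agree.\<close>
      have "0 \<le> a k \<bullet> u i \<longleftrightarrow> 0 \<le> l * (a k \<bullet> u i)"
        using side[of k i j] ij k eq by (simp add: aw)
      then show False using False l(3) by (auto simp: zero_le_mult_iff)
    qed
  next
    case False
    obtain i j k where ijk: "I = {i, j, k}" "i \<noteq> j" "i \<noteq> k" "j \<noteq> k"
      using I card_3_iff by metis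
    have nz: "a x \<bullet> u y \<noteq> 0" if "x \<in> I" "y \<in> I" "x \<noteq> y" for x y
      using False that by blast
    have s: "0 \<le> a x \<bullet> u y \<longleftrightarrow> 0 \<le> a x \<bullet> u z"
      if "x \<in> I" "y \<in> I" "z \<in> I" "distinct [x, y, z]" for x y z
      using side[OF that] that by (simp add: aw)
    have "a i \<noteq> 0" "a j \<noteq> 0" using nz[of i j] nz[of j i] ijk by auto
    moreover have "a i \<noteq> c *\<^sub>R a j" for c
      using self[of i] nz[of j i] nz[of i j] self[of j] ijk by auto
    moreover have "a x \<bullet> v = 0" if "x \<in> {i,j,k}" "v \<in> D" for x v
      using aD that ijk by simp
    ultimately obtain \<alpha> \<beta> where ab: "a k = \<alpha> *\<^sub>R a i + \<beta> *\<^sub>R a j"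
      using three_orthogonal_functionals[OF D, of i j k a] by metis
    \<comment> \<open>The relation for \<open>a k\<close> is paired with each \<open>u\<close>;
      terms pairing a normal with its own apex vanish by \<open>self\<close>.\<close>
    have 1: "a k \<bullet> u i = \<beta> * (a j \<bullet> u i)" "a k \<bullet> u j = \<alpha> * (a i \<bullet> u j)"
      "0 = \<alpha> * (a i \<bullet> u k) + \<beta> * (a j \<bullet> u k)"
      using self ijk self[of k] by (simp_all add: ab inner_add_left)
    have 2: "0 \<le> a k \<bullet> u i \<longleftrightarrow> 0 \<le> a k \<bullet> u j" "0 \<le> a i \<bullet> u j \<longleftrightarrow> 0 \<le> a i \<bullet> u k"
      "0 \<le> a j \<bullet> u i \<longleftrightarrow> 0 \<le> a j \<bullet> u k"
      using s[of k i j] s[of i j k] s[of j i k] ijk by auto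
    have 3: "a k \<bullet> u i \<noteq> 0" "a k \<bullet> u j \<noteq> 0" "a i \<bullet> u j \<noteq> 0" "a i \<bullet> u k \<noteq> 0" "a j \<bullet> u i \<noteq> 0" "a j \<bullet> u k \<noteq> 0"
      using nz ijk by auto
    \<comment> \<open>By \<open>2\<close> the factors at \<open>u k\<close> have the signs of those
      in \<open>a k \<bullet> u j\<close> and \<open>a k \<bullet> u i\<close>, which agree. So two
      nonzero terms of equal sign would sum to zero.\<close>
    have "0 \<le> \<alpha> * (a i \<bullet> u k) \<longleftrightarrow> 0 \<le> \<beta> * (a j \<bullet> u k)" "\<alpha> * (a i \<bullet> u k) \<noteq> 0"
      using 1(1,2) 2 3 by (auto simp: zero_le_mult_iff)
    then show False using 1(3) by linarith
  qed
qed

section \<open>Dimensions of convex balls and of affine images\<close>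

text \<open>Homeomorphic convex sets have equal affine dimension, and the unit ball of
  \<open>V\<close> spans \<open>V\<close> because the open ball meets \<open>V\<close> at 0.\<close>

lemma aff_dim_is_top_ball:
  fixes S :: "'b::euclidean_space set"
  assumes "is_top_ball k S" "convex S"
  shows "aff_dim S = int k"
proof -
  obtain V :: "'b set" where V: "subspace V" "dim V = k" "S homeomorphic (cball 0 1 \<inter> V)"
    using assms(1) by (auto simp: is_top_ball_def)
  have "aff_dim S = aff_dim (V \<inter> cball 0 1)"
    using V assms(2) by (intro homeomorphic_convex_sets)
      (auto simp: Int_commute intro: convex_Int subspace_imp_convex)
  also have "\<dots> = aff_dim V"
    using subspace_0[OF V(1)] subspace_imp_convex[OF V(1)] interior_cball[of "0::'b" 1]
    by (intro aff_dim_convex_Int_nonempty_interior) force+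
  finally show ?thesis using V by (simp add: aff_dim_subspace)
qed

lemma convex_affine_map_image:
  assumes "affine_map_on S f" "convex C" "C \<subseteq> S"
  shows "convex (f ` C)"
proof -
  obtain A b where A: "linear A" "\<And>x. x \<in> S \<Longrightarrow> f x = A x + b"
    using assms(1) by (auto simp: affine_map_on_def)
  have "f ` C = (\<lambda>x. b + x) ` (A ` C)"
    using A(2) assms(3) by (auto simp: image_iff subset_iff add.commute)
  then show ?thesis
    using A(1) assms(2) by (metis convex_linear_image convex_translation)
qed

lemma affine_map_image_convex_hull:
  assumes "affine_map_on S f" "convex hull C \<subseteq> S"
  shows "f ` (convex hull C) = convex hull (f ` C)"
proof -
  obtain A b where A: "linear A" "\<And>x. x \<in> S \<Longrightarrow> f x = A x + b"
    using assms(1) by (auto simp: affine_map_on_def)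
  have eq: "f ` T = (\<lambda>x. b + x) ` (A ` T)" if "T \<subseteq> S" for T
    using A(2) that by (auto simp: image_iff subset_iff add.commute)
  have "C \<subseteq> S" using assms(2) hull_subset[of C convex] by auto
  then show ?thesis
    by (simp add: eq assms(2) convex_hull_translation convex_hull_linear_image A(1))
qed

text \<open>\<open>A\<close> is injective only along \<open>S\<close>, so the argument is
  topological: by compactness \<open>f\<close> is a homeomorphism from \<open>C\<close> onto its
  convex image.\<close>

lemma aff_dim_affine_map_image:
  fixes S :: "'a::euclidean_space set" and f :: "'a \<Rightarrow> 'b::euclidean_space"
  assumes "affine_map_on S f" "inj_on f S" "convex C" "compact C" "C \<subseteq> S"
  shows "aff_dim (f ` C) = aff_dim C"
proof -
  obtain A b where A: "linear A" "\<And>x. x \<in> S \<Longrightarrow> f x = A x + b"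
    using assms(1) by (auto simp: affine_map_on_def)
  have "continuous_on C (\<lambda>x. A x + b)"
    using A(1) by (intro continuous_intros linear_continuous_on) (simp add: linear_conv_bounded_linear)
  then have "continuous_on C f"
    by (rule continuous_on_eq) (use A assms(5) in auto)
  then have "C homeomorphic (f ` C)"
    using assms by (intro homeomorphic_compact) (auto intro: inj_on_subset)
  then show ?thesis
    using convex_affine_map_image[OF assms(1,3,5)] assms(3) homeomorphic_convex_sets by metis
qed

section \<open>Ridges of a simplex\<close>

text \<open>A face is spanned by a subset of the vertices; comparing dimensions, exactly one vertex
  is missing.\<close>

lemma simplex_ridge_apex:
  assumes "int e simplex S" "R face_of S" "(int e - 1) simplex R"
  obtains v C where "finite C" "S = convex hull (insert v C)" "R = convex hull C"
proof -
  obtain B where B: "finite B" "\<not> affine_dependent B" "int (card B) = int e + 1" "S = convex hull B"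
    using assms(1) by (auto simp: simplex)
  obtain C where C: "C \<subseteq> B" "R = convex hull C"
    using assms(2) B by (auto simp: face_of_convex_hull_affine_independent)
  have "aff_dim R = int e - 1"
    using assms(3) aff_dim_simplex by blast
  moreover have "int (card C) = aff_dim C + 1"
    using affine_independent_subset[OF B(2) C(1)] by (simp add: aff_dim_affine_independent)
  ultimately have "card (B - C) = 1"
    using B C card_Diff_subset[of C B] by (simp add: finite_subset aff_dim_convex_hull)
  then obtain v where "B - C = {v}" by (auto simp: card_1_singleton_iff)
  then have "B = insert v C" using C(1) by auto
  then show thesis using that[of C v] B C by (simp add: finite_subset)
qed

text \<open>Each vertex has an opposite ridge. If two of these coincided, a vertex would lie in the
  affine hull of the others.\<close>

lemma card_simplex_ridges_ge:
  fixes S :: "'a::euclidean_space set"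
  assumes "int e simplex S"
  shows "e + 1 \<le> card {R. R face_of S \<and> (int e - 1) simplex R}"
proof -
  obtain B where B: "finite B" "\<not> affine_dependent B" "int (card B) = int e + 1" "S = convex hull B"
    using assms by (auto simp: simplex)
  let ?h = "\<lambda>v. convex hull (B - {v})"
  have "inj_on ?h B"
  proof (rule inj_onI, rule ccontr)
    fix u v assume uv: "u \<in> B" "v \<in> B" "?h u = ?h v" "u \<noteq> v"
    then have "u \<in> ?h v" by (auto intro: hull_inc)
    then have "u \<in> affine hull (B - {u})"
      using uv(3) convex_hull_subset_affine_hull[of "B - {u}"] by auto
    then show False using B(2) uv(1) by (auto simp: affine_dependent_def)
  qed
  moreover have "?h ` B \<subseteq> {R. R face_of S \<and> (int e - 1) simplex R}"
  proof clarify
    fix v assume v: "v \<in> B"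
    have "?h v face_of S"
      using B by (auto simp: face_of_convex_hull_affine_independent)
    moreover have "(int e - 1) simplex ?h v"
      unfolding simplex_def
      using B v by (intro exI[of _ "B - {v}"]) (auto simp: affine_independent_Diff card_Diff_singleton of_nat_diff)
    ultimately show "?h v face_of S \<and> (int e - 1) simplex ?h v" by simp
  qed
  moreover have "finite {R. R face_of S \<and> (int e - 1) simplex R}"
  proof (rule finite_subset)
    show "finite {R. R face_of S}"
      unfolding B(4) using B(1) by (intro finite_polytope_faces polytope_convex_hull)
  qed auto
  ultimately have "card B \<le> card {R. R face_of S \<and> (int e - 1) simplex R}"
    by (metis card_inj_on_le)
  then show ?thesis using B(3) by linarith
qed

section \<open>Counting unblocked sides\<close>

text \<open>For the ridges of one facet. If some ridge is blocked on both sides, all others are free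
  on both, and \<open>2 * (card X - 1) \<ge> card X\<close>; otherwise every ridge has a free
  side.\<close>

lemma card_unblocked_sides_ge:
  fixes blk :: "'r \<Rightarrow> bool \<Rightarrow> bool"
  assumes "finite X" "card X \<ge> 2"
    and sep: "\<And>R R'. R \<in> X \<Longrightarrow> R' \<in> X \<Longrightarrow> blk R True \<Longrightarrow> blk R' False \<Longrightarrow> R = R'"
  shows "card X \<le> (\<Sum>R\<in>X. card {s. \<not> blk R s})"
proof (cases "\<exists>R\<in>X. blk R True \<and> blk R False")
  case True
  then obtain R where R: "R \<in> X" "blk R True" "blk R False" by blast
  have "{s. \<not> blk Q s} = UNIV" if "Q \<in> X - {R}" for Q
    using sep[of R Q] sep[of Q R] R that by (auto, metis (full_types))
  then have "(\<Sum>Q\<in>X - {R}. card {s. \<not> blk Q s}) = 2 * (card X - 1)"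
    using assms(1) R(1) by simp
  moreover have "(\<Sum>Q\<in>X - {R}. card {s. \<not> blk Q s}) \<le> (\<Sum>Q\<in>X. card {s. \<not> blk Q s})"
    using assms(1) by (intro sum_mono2) auto
  ultimately show ?thesis using assms(2) by linarith
next
  case False
  have "1 \<le> card {s. \<not> blk R s}" if "R \<in> X" for R
    using False that by (auto simp: Suc_le_eq card_gt_0_iff)
  then have "(\<Sum>R\<in>X. 1) \<le> (\<Sum>R\<in>X. card {s. \<not> blk R s})" by (intro sum_mono) auto
  then show ?thesis by simp
qed

text \<open>For the facets at one ridge. A lone facet has two free sides. Otherwise each has at most
  one, and among three facets with a free side one would have the other two on different sides,
  hence no free side.\<close>

lemma card_unblocked_sides_le:
  fixes side :: "'i \<Rightarrow> 'i \<Rightarrow> bool"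
  assumes fin: "finite Y"
    and three: "\<And>I. I \<subseteq> Y \<Longrightarrow> card I = 3 \<Longrightarrow>
      \<exists>i\<in>I. \<exists>j\<in>I. \<exists>k\<in>I. distinct [i, j, k] \<and> side i j \<noteq> side i k"
  shows "(\<Sum>i\<in>Y. card {s. \<not> (\<exists>j\<in>Y - {i}. side i j = s)}) \<le> 2"
proof (cases "\<exists>i\<in>Y. Y - {i} = {}")
  case True
  then obtain i where "Y = {i}" by auto
  then show ?thesis by (simp add: card_UNIV_bool)
next
  case False
  let ?M = "\<lambda>i. {s. \<not> (\<exists>j\<in>Y - {i}. side i j = s)}"
  define Z where "Z = {i \<in> Y. ?M i \<noteq> {}}"
  have "card (?M i) \<le> (if i \<in> Z then 1 else 0)" if i: "i \<in> Y" for i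
  proof -
    obtain j where "j \<in> Y - {i}" using False i by blast
    then have "?M i \<subseteq> {\<not> side i j}" by auto
    then have "card (?M i) \<le> card {\<not> side i j}" by (intro card_mono) auto
    then show ?thesis using i by (auto simp: Z_def)
  qed
  then have "(\<Sum>i\<in>Y. card (?M i)) \<le> (\<Sum>i\<in>Y. if i \<in> Z then 1 else 0)"
    by (intro sum_mono) auto
  also have "\<dots> = card Z"
    using fin by (simp add: Z_def flip: sum.inter_filter)
  also have "\<dots> \<le> 2"
  proof (rule ccontr)
    assume "\<not> card Z \<le> 2"
    then obtain I where I: "I \<subseteq> Z" "card I = 3"
      using obtain_subset_with_card_n[of 3 Z] by auto
    moreover have "Z \<subseteq> Y" by (auto simp: Z_def)
    ultimately obtain i j k where "i \<in> I" "j \<in> I" "k \<in> I" "distinct [i, j, k]" "side i j \<noteq> side i k"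
      using three[of I] by blast
    then have "j \<in> Y - {i}" "k \<in> Y - {i}" "i \<in> Z"
      using I(1) by (auto simp: Z_def)
    then show False using \<open>side i j \<noteq> side i k\<close> by (auto simp: Z_def)
  qed
  finally show ?thesis .
qed

theorem theorem5p1:
  fixes K :: "'a::euclidean_space set set" and d m n :: nat
  assumes "d \<ge> 2"
    and "CARD('d::finite) = d"
    and "\<exists>f :: 'a \<Rightarrow> real ^ 'd. linear_thrackle_map (d - 1) K f"
    and "m = card (facets (d - 1) K)"
    and "n = card (ridges (d - 1) K)"
  shows "d * m \<le> 2 * n"
proof -

  \<comment> \<open>Geometry of the facet images\<close>
  define e where "e = d - 1"
  have e: "1 \<le> e" "int DIM(real ^ 'd) = int e + 1" "d = e + 1"
    using assms(1,2) by (auto simp: e_def)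
  obtain f :: "'a \<Rightarrow> real ^ 'd" where f: "linear_thrackle_map e K f"
    using assms(3) by (auto simp: e_def)
  define F where "F = facets e K"
  define Rd where "Rd = ridges e K"
  have K: "simplicial_complex K"
    using f by (auto simp: linear_thrackle_map_def thrackle_map_def pure_complex_def)
  then have fin: "finite F" "finite Rd"
    by (auto simp: F_def Rd_def facets_def ridges_def dim_faces_def simplicial_complex_def)
  have F: "\<sigma> \<in> K" "int e simplex \<sigma>" "affine_map_on \<sigma> f" "inj_on f \<sigma>" "compact \<sigma>" "convex \<sigma>"
    if "\<sigma> \<in> F" for \<sigma>
  proof -
    show "\<sigma> \<in> K" "int e simplex \<sigma>" using that by (auto simp: F_def facets_def dim_faces_def)
    then show "compact \<sigma>" "convex \<sigma>" using compact_simplex convex_simplex by auto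
    show "affine_map_on \<sigma> f" using f that by (auto simp: linear_thrackle_map_def F_def)
    have "embedding_map (top_of_set \<sigma>) euclidean f"
      using f that by (auto simp: linear_thrackle_map_def thrackle_map_def F_def)
    then show "inj_on f \<sigma>"
      by (auto simp: embedding_map_def dest: homeomorphic_imp_injective_map)
  qed
  have R: "aff_dim (f ` R) = int e - 1" "convex (f ` R)" "f ` R \<noteq> {}" "f ` R \<subseteq> f ` \<sigma>" "aff_dim R = int e - 1"
    if "\<sigma> \<in> F" "R \<in> Rd" "R face_of \<sigma>" for \<sigma> R
  proof -
    have s: "(int e - 1) simplex R"
      using that by (auto simp: Rd_def ridges_def dim_faces_def)
    have sub: "R \<subseteq> \<sigma>" using that(3) face_of_imp_subset by blast
    show "aff_dim R = int e - 1" using s aff_dim_simplex by blast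
    then show d: "aff_dim (f ` R) = int e - 1"
      using aff_dim_affine_map_image[of \<sigma> f R] F[OF that(1)] sub s compact_simplex convex_simplex by metis
    show "convex (f ` R)"
      using convex_affine_map_image F(3)[OF that(1)] sub s convex_simplex by metis
    show "f ` R \<noteq> {}" using d e(1) by auto
    show "f ` R \<subseteq> f ` \<sigma>" using sub by auto
  qed
  have F_dim: "aff_dim (f ` \<sigma>) = int e" if "\<sigma> \<in> F" for \<sigma>
    using aff_dim_affine_map_image[of \<sigma> f \<sigma>] F[OF that] aff_dim_simplex by fastforce
  have "\<exists>w. f ` \<sigma> = convex hull (insert w (f ` R)) \<and> w \<notin> affine hull (f ` R)"
    if *: "\<sigma> \<in> F" "R \<in> Rd" "R face_of \<sigma>" for \<sigma> R
  proof -
    have "(int e - 1) simplex R"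
      using * by (auto simp: Rd_def ridges_def dim_faces_def)
    then obtain v C where C: "\<sigma> = convex hull (insert v C)" "R = convex hull C"
      using simplex_ridge_apex[OF F(2)[OF *(1)] *(3)] by metis
    have "f ` \<sigma> = convex hull (insert (f v) (f ` C))"
      using affine_map_image_convex_hull[OF F(3)[OF *(1)], of "insert v C"] C by simp
    moreover have "f ` R = convex hull (f ` C)"
      using affine_map_image_convex_hull[OF F(3)[OF *(1)], of C] C face_of_imp_subset[OF *(3)] by simp
    ultimately have eq: "f ` \<sigma> = convex hull (insert (f v) (f ` R))"
      by (metis hull_insert)
    have "f v \<notin> affine hull (f ` R)"
    proof
      assume "f v \<in> affine hull (f ` R)"
      then have "aff_dim (insert (f v) (f ` R)) = aff_dim (f ` R)" by (simp add: aff_dim_insert)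
      then show False
        using F_dim[OF *(1)] R(1)[OF *] eq by (simp add: aff_dim_convex_hull)
    qed
    then show ?thesis using eq by blast
  qed
  then obtain w where w: "f ` \<sigma> = convex hull (insert (w \<sigma> R) (f ` R))" "w \<sigma> R \<notin> affine hull (f ` R)"
    if "\<sigma> \<in> F" "R \<in> Rd" "R face_of \<sigma>" for \<sigma> R
    by metis
  have "\<exists>a b. affine hull (f ` \<sigma>) = {x. a \<bullet> x = b}" if "\<sigma> \<in> F" for \<sigma>
    using aff_dim_eq_hyperplane[of "f ` \<sigma>"] F_dim[OF that] e by auto
  then obtain a b where ab: "affine hull (f ` \<sigma>) = {x. a \<sigma> \<bullet> x = b \<sigma>}" if "\<sigma> \<in> F" for \<sigma>
    by metis
  \<comment> \<open>The intersection of two facet images is convex, so the ball condition fixes its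
    dimension.\<close>
  have cap_dim: "aff_dim (f ` \<sigma> \<inter> f ` \<tau>) = int e - 1" if "\<sigma> \<in> F" "\<tau> \<in> F" "\<sigma> \<noteq> \<tau>" for \<sigma> \<tau>
  proof -
    have "is_top_ball (e - 1) (f ` \<sigma> \<inter> f ` \<tau>)"
      using f that by (auto simp: linear_thrackle_map_def thrackle_map_def F_def)
    moreover have "convex (f ` \<sigma> \<inter> f ` \<tau>)"
      using convex_affine_map_image F(3,6) that by (metis convex_Int order_refl)
    ultimately show ?thesis using e(1) by (simp add: aff_dim_is_top_ball of_nat_diff)
  qed
  have meet: "f ` \<sigma> \<inter> f ` \<tau> \<subseteq> affine hull (f ` R)"
    if "\<sigma> \<in> F" "\<tau> \<in> F" "\<sigma> \<noteq> \<tau>" "R \<in> Rd" "R face_of \<sigma>" "R face_of \<tau>" for \<sigma> \<tau> R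
  proof -
    have "f ` R \<subseteq> f ` \<sigma> \<inter> f ` \<tau>" using R(4) that by blast
    then have "affine hull (f ` R) = affine hull (f ` \<sigma> \<inter> f ` \<tau>)"
      using cap_dim[OF that(1-3)] R(1,3)[OF that(1,4,5)]
      by (intro affine_dim_equal) (auto simp: hull_mono)
    then show ?thesis by (simp add: hull_subset)
  qed

  \<comment> \<open>Blocked sides at the ridges of a facet\<close>
  define inc where "inc \<sigma> = {R \<in> Rd. R face_of \<sigma>}" for \<sigma>
  define nbrs where "nbrs R = {\<sigma> \<in> F. R face_of \<sigma>}" for R
  define side where "side R \<sigma> \<tau> \<longleftrightarrow> b \<sigma> \<le> a \<sigma> \<bullet> w \<tau> R" for R \<sigma> \<tau>
  define blk where "blk \<sigma> R s \<longleftrightarrow> (\<exists>\<tau> \<in> nbrs R - {\<sigma>}. side R \<sigma> \<tau> = s)" for \<sigma> R s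
  have sep: "R = R'"
    if \<sigma>: "\<sigma> \<in> F" and R1: "R \<in> inc \<sigma>" and R2: "R' \<in> inc \<sigma>"
      and blk: "blk \<sigma> R True" "blk \<sigma> R' False" for \<sigma> R R'
  proof -
    obtain \<tau> where \<tau>: "\<tau> \<in> F" "R face_of \<tau>" "\<tau> \<noteq> \<sigma>" "b \<sigma> \<le> a \<sigma> \<bullet> w \<tau> R"
      using blk(1) unfolding blk_def side_def nbrs_def by blast
    obtain \<tau>' where \<tau>': "\<tau>' \<in> F" "R' face_of \<tau>'" "\<tau>' \<noteq> \<sigma>" "a \<sigma> \<bullet> w \<tau>' R' < b \<sigma>"
      using blk(2) unfolding blk_def side_def nbrs_def not_le[symmetric] by blast
    have RR: "R \<in> Rd" "R face_of \<sigma>" "R' \<in> Rd" "R' face_of \<sigma>" using R1 R2 by (auto simp: inc_def)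
    have face: "R \<inter> R' face_of \<sigma>" using RR by (intro face_of_Int)
    define H where "H = {x. a \<sigma> \<bullet> x = b \<sigma>}"
    have fH: "f ` \<sigma> \<subseteq> H" using ab[OF \<sigma>] hull_subset[of "f ` \<sigma>" affine] by (auto simp: H_def)
    then have RH: "f ` R \<subseteq> H" "f ` R' \<subseteq> H" using R(4) \<sigma> RR by blast+
    have up: "f ` \<tau> \<subseteq> {x. a \<sigma> \<bullet> x \<ge> b \<sigma>}"
      unfolding w(1)[OF \<tau>(1) RR(1) \<tau>(2)]
      using RH \<tau>(4) by (intro hull_minimal convex_halfspace_ge) (auto simp: H_def)
    have down: "f ` \<tau>' \<subseteq> {x. a \<sigma> \<bullet> x \<le> b \<sigma>}"
      unfolding w(1)[OF \<tau>'(1) RR(3) \<tau>'(2)]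
      using RH \<tau>'(4) by (intro hull_minimal convex_halfspace_le) (auto simp: H_def)
    have "w \<tau>' R' \<in> f ` \<tau>'"
      unfolding w(1)[OF \<tau>'(1) RR(3) \<tau>'(2)] by (simp add: hull_inc)
    then have ne: "\<tau> \<noteq> \<tau>'" using up \<tau>'(4) by auto
    \<comment> \<open>The apex of \<tau>' is strictly below \<open>H\<close>, so \<tau>' touches
      \<open>H\<close> only in its base; as \<tau> is on or above \<open>H\<close>, the two can meet
      only there.\<close>
    have "f ` \<tau>' \<inter> H = f ` R'"
      unfolding w(1)[OF \<tau>'(1) RR(3) \<tau>'(2)]
      using \<tau>'(4) RH R(2,3)[OF \<sigma> RR(3,4)]
      by (intro convex_hull_insert_Int_affine) (auto simp: H_def affine_hyperplane)
    moreover have "f ` \<tau> \<inter> f ` \<tau>' \<subseteq> H"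
      using up down unfolding H_def by fastforce
    ultimately have 1: "f ` \<tau> \<inter> f ` \<tau>' \<subseteq> f ` R'" by blast
    have "f ` \<sigma> \<inter> affine hull (f ` R) = f ` R"
      unfolding w(1)[OF \<sigma> RR(1,2)]
      using R(2,3)[OF \<sigma> RR(1,2)] w(2)[OF \<sigma> RR(1,2)]
      by (intro convex_hull_insert_Int_affine) (auto simp: hull_subset)
    moreover have "f ` \<sigma> \<inter> f ` \<tau> \<subseteq> affine hull (f ` R)"
      using meet \<sigma> \<tau> RR by metis
    moreover have "Y \<inter> Z \<subseteq> A \<inter> B"
      if "X \<inter> C = A" "X \<inter> Y \<subseteq> C" "Y \<inter> Z \<subseteq> B" "B \<subseteq> X" for A B C X Y Z :: "(real ^ 'd) set"
      using that by blast
    ultimately have "f ` \<tau> \<inter> f ` \<tau>' \<subseteq> f ` R \<inter> f ` R'"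
      using 1 R(4)[OF \<sigma> RR(3,4)] by metis
    also have "\<dots> = f ` (R \<inter> R')"
      using F(4)[OF \<sigma>] RR face_of_imp_subset by (metis inj_on_image_Int)
    finally have "int e - 1 \<le> aff_dim (f ` (R \<inter> R'))"
      using cap_dim[OF \<tau>(1) \<tau>'(1) ne] aff_dim_subset by metis
    also have "\<dots> = aff_dim (R \<inter> R')"
    proof (rule aff_dim_affine_map_image[OF F(3,4)[OF \<sigma>]])
      show "convex (R \<inter> R')" using face by (rule face_of_imp_convex)
      show "compact (R \<inter> R')" using F(6,5)[OF \<sigma>] face by (rule face_of_imp_compact)
      show "R \<inter> R' \<subseteq> \<sigma>" using face by (rule face_of_imp_subset)
    qed
    finally have ge: "int e - 1 \<le> aff_dim (R \<inter> R')" .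
    \<comment> \<open>A proper face of a ridge has dimension below \<open>e - 1\<close>, which
      \<open>ge\<close> excludes; so \<open>R \<inter> R'\<close> equals both ridges.\<close>
    have whole: "R \<inter> R' = Q" if "Q \<in> Rd" "Q face_of \<sigma>" "R \<inter> R' \<subseteq> Q" for Q
    proof (rule ccontr)
      have "R \<inter> R' face_of Q"
        using face_of_subset[OF face that(3) face_of_imp_subset[OF that(2)]] .
      moreover assume "R \<inter> R' \<noteq> Q"
      ultimately show False
        using face_of_aff_dim_lt[OF face_of_imp_convex[OF that(2)]] R(5)[OF \<sigma> that(1,2)] ge by fastforce
    qed
    have "R \<inter> R' = R" "R \<inter> R' = R'"
      by (rule whole[OF RR(1,2) Int_lower1], rule whole[OF RR(3,4) Int_lower2])
    then show "R = R'" by simp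
  qed
  have inc_card: "d \<le> card (inc \<sigma>)" if "\<sigma> \<in> F" for \<sigma>
  proof -
    \<comment> \<open>\<open>K\<close> is closed under faces, so every ridge of the simplex \<sigma>
      is a ridge of the complex.\<close>
    have "inc \<sigma> = {R. R face_of \<sigma> \<and> (int e - 1) simplex R}"
      using F(1)[OF that] K by (auto simp: inc_def Rd_def ridges_def dim_faces_def simplicial_complex_def)
    then show ?thesis using card_simplex_ridges_ge[OF F(2)[OF that]] e by simp
  qed
  have facet: "d \<le> (\<Sum>R\<in>inc \<sigma>. card {s. \<not> blk \<sigma> R s})" if "\<sigma> \<in> F" for \<sigma>
  proof -
    have "card (inc \<sigma>) \<le> (\<Sum>R\<in>inc \<sigma>. card {s. \<not> blk \<sigma> R s})"
      using inc_card[OF that] assms(1) fin sep[OF that]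
      by (intro card_unblocked_sides_ge) (auto simp: inc_def)
    then show ?thesis using inc_card[OF that] by simp
  qed
  have ridge: "(\<Sum>\<sigma>\<in>nbrs R. card {s. \<not> blk \<sigma> R s}) \<le> 2" if "R \<in> Rd" for R
    unfolding blk_def
  proof (rule card_unblocked_sides_le)
    show "finite (nbrs R)" using fin by (simp add: nbrs_def)
    fix I assume I: "I \<subseteq> nbrs R" "card I = 3"
    then have IF: "\<sigma> \<in> F" "R face_of \<sigma>" if "\<sigma> \<in> I" for \<sigma> using that by (auto simp: nbrs_def)
    obtain \<sigma> where \<sigma>: "\<sigma> \<in> I" using I(2) by fastforce
    show "\<exists>i\<in>I. \<exists>j\<in>I. \<exists>k\<in>I. distinct [i, j, k] \<and> side R i j \<noteq> side R i k"
    proof (rule ccontr)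
      assume "\<not> ?thesis"
      then have s: "b i \<le> a i \<bullet> w j R \<longleftrightarrow> b i \<le> a i \<bullet> w k R"
        if "i \<in> I" "j \<in> I" "k \<in> I" "distinct [i, j, k]" for i j k
        using that unfolding side_def by blast
      have hull: "affine hull (insert (w i R) (f ` R)) = {x. a i \<bullet> x = b i}" if "i \<in> I" for i
        using ab[OF IF(1)[OF that]] w(1)[OF IF(1)[OF that] \<open>R \<in> Rd\<close> IF(2)[OF that]] by simp
      have cap: "convex hull (insert (w i R) (f ` R)) \<inter> convex hull (insert (w j R) (f ` R)) \<subseteq> affine hull (f ` R)"
        if "i \<in> I" "j \<in> I" "i \<noteq> j" for i j
        using meet[of i j R] w(1)[of i R] w(1)[of j R] IF that \<open>R \<in> Rd\<close> by simp
      have dim: "aff_dim (f ` R) = int DIM(real ^ 'd) - 2"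
        using R(1)[OF IF(1)[OF \<sigma>] \<open>R \<in> Rd\<close> IF(2)[OF \<sigma>]] e by simp
      show False
      proof (rule three_simplices_around_ridge[of "f ` R" I "\<lambda>i. w i R" a b])
        show "convex (f ` R)" "f ` R \<noteq> {}"
          using R(2,3)[OF IF(1)[OF \<sigma>] \<open>R \<in> Rd\<close> IF(2)[OF \<sigma>]] by auto
        show "aff_dim (f ` R) = int DIM(real ^ 'd) - 2" by (fact dim)
        show "w i R \<notin> affine hull (f ` R)" if "i \<in> I" for i
          using w(2)[OF IF(1)[OF that] \<open>R \<in> Rd\<close> IF(2)[OF that]] .
      qed (fact hull cap I s)+
    qed
  qed

  \<comment> \<open>Double count of unblocked triples, by facets and then by ridges\<close>
  have "d * m = (\<Sum>\<sigma>\<in>F. d)" using assms(4) by (simp add: F_def e_def)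
  also have "\<dots> \<le> (\<Sum>\<sigma>\<in>F. \<Sum>R\<in>inc \<sigma>. card {s. \<not> blk \<sigma> R s})"
    by (intro sum_mono facet)
  also have "\<dots> = (\<Sum>R\<in>Rd. \<Sum>\<sigma>\<in>nbrs R. card {s. \<not> blk \<sigma> R s})"
    unfolding inc_def nbrs_def by (rule sum.swap_restrict[OF fin])
  also have "\<dots> \<le> (\<Sum>R\<in>Rd. 2)" by (intro sum_mono ridge)
  also have "\<dots> = 2 * n" using assms(5) by (simp add: Rd_def e_def)
  finally show ?thesis .
qed

end
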